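(* Let $J$ be a free ideal on a set $S$ such that $S\notin\langle J\rangle$, let $k$ be a positive integer, and let $\mathcal{A}$ be a cofinal subfamily of $(\langle J\rangle,\subset)$ such that: 1. TWO has a winning $k$-tactic in $MG(\mathcal{A},J)$; 2. there are functions $\Phi_1:\langle J\rangle\to J$ and $\Phi_2:\langle J\rangle\to\mathcal{A}$ such that (a) $A\subset\Phi_2(A)$ for each $A\in\langle J\rangle$, and (b) $\Phi_2(A)\subset\Phi_2(B)$ whenever $A,B\in\langle J\rangle$ and $A\cup\Phi_1(A)\subseteq B$. Then TWO has a winning $2$-tactic in $SMG(J)$.
   Context: The symbol $\subset$ always means "is a proper subset of". A free ideal $J$ on $S$ is an ideal of subsets of $S$ with $\bigcup J=S$; $\langle J\rangle$ is the $\sigma$-completion of $J$, i.e. the collection of all unions of countably many members of $J$. $\mathcal{A}\subseteq\langle J\rangle$ is cofinal if every element of $\langle J\rangle$ is contained in an element of $\mathcal{A}$. Game $MG(\mathcal{A},J)$: in inning $n$ ($n=1,2,\dots$) ONE plays $O_n\in\mathcal{A}$ and TWO responds with $T_n\in J$; ONE must satisfy $O_n\subset O_{n+1}$ for all $n$. TWO wins if $\bigcup_n O_n\subseteq\bigcup_n T_n$. Game $SMG(J)$: in inning $n$ ONE plays $O_n\in\langle J\rangle$ and TWO responds with $T_n\in J$; ONE must satisfy $O_n\cup T_n\subseteq O_{n+1}$ for all $n$. TWO wins if $\bigcup_n O_n=\bigcup_n T_n$. A $k$-tactic for TWO in either game is a function $F$ assigning an element of $J$ to each sequence of length at most $k$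 (and at least $1$) of possible successive moves of ONE; it is winning if TWO wins every play with $T_j=F(O_1,\dots,O_j)$ for $j\le k$ and $T_{n+k}=F(O_{n+1},\dots,O_{n+k})$ for all $n\ge 1$. *)

theory Defs
  imports "HOL-Library.Countable_Set"
begin

definition free_ideal :: "'a set \<Rightarrow> 'a set set \<Rightarrow> bool" where
  "free_ideal S J \<longleftrightarrow>
     J \<subseteq> Pow S \<and> {} \<in> J \<and>
     (\<forall>A\<in>J. \<forall>B. B \<subseteq> A \<longrightarrow> B \<in> J) \<and>
     (\<forall>A\<in>J. \<forall>B\<in>J. A \<union> B \<in> J) \<and>
     \<Union>J = S"

definition sigma_completion :: "'a set set \<Rightarrow> 'a set set" where
  "sigma_completion J = {\<Union>C |C. countable C \<and> C \<subseteq> J}"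

definition cofinal_subfamily :: "'a set set \<Rightarrow> 'a set set \<Rightarrow> bool" where
  "cofinal_subfamily \<A> \<B> \<longleftrightarrow> \<A> \<subseteq> \<B> \<and> (\<forall>B\<in>\<B>. \<exists>A\<in>\<A>. B \<subseteq> A)"

text \<open>
  A play is a pair of sequences: \<open>X n\<close> and \<open>Y n\<close> are the moves of ONE and of TWO.
  Innings are numbered from 0.
\<close>

definition MG_play ::
  "'a set set \<Rightarrow> 'a set set \<Rightarrow> (nat \<Rightarrow> 'a set) \<Rightarrow> (nat \<Rightarrow> 'a set) \<Rightarrow> bool" where
  "MG_play \<A> J X Y \<longleftrightarrow> (\<forall>n. X n \<in> \<A> \<and> Y n \<in> J \<and> X n \<subset> X (Suc n))"

definition MG_won_by_TWO :: "(nat \<Rightarrow> 'a set) \<Rightarrow> (nat \<Rightarrow> 'a set) \<Rightarrow> bool" where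
  "MG_won_by_TWO X Y \<longleftrightarrow> (\<Union>n. X n) \<subseteq> (\<Union>n. Y n)"

definition SMG_play ::
  "'a set set \<Rightarrow> (nat \<Rightarrow> 'a set) \<Rightarrow> (nat \<Rightarrow> 'a set) \<Rightarrow> bool" where
  "SMG_play J X Y \<longleftrightarrow>
     (\<forall>n. X n \<in> sigma_completion J \<and> Y n \<in> J \<and> X n \<union> Y n \<subseteq> X (Suc n))"

definition SMG_won_by_TWO :: "(nat \<Rightarrow> 'a set) \<Rightarrow> (nat \<Rightarrow> 'a set) \<Rightarrow> bool" where
  "SMG_won_by_TWO X Y \<longleftrightarrow> (\<Union>n. X n) = (\<Union>n. Y n)"

text \<open>
  The list \<open>last_moves k X n\<close> consists of the \<open>k\<close> most recent of the moves
  \<open>X 0, \<dots>, X n\<close>, oldest first. Since subtraction is truncated, it is all of them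
  if \<open>Suc n \<le> k\<close>.
\<close>

definition last_moves :: "nat \<Rightarrow> (nat \<Rightarrow> 'a set) \<Rightarrow> nat \<Rightarrow> 'a set list" where
  "last_moves k X n = map X [Suc n - k..<Suc n]"

definition follows_tactic ::
  "nat \<Rightarrow> ('a set list \<Rightarrow> 'a set) \<Rightarrow> (nat \<Rightarrow> 'a set) \<Rightarrow> (nat \<Rightarrow> 'a set) \<Rightarrow> bool" where
  "follows_tactic k F X Y \<longleftrightarrow> (\<forall>n. Y n = F (last_moves k X n))"

text \<open>
  The values of \<open>F\<close> are required to lie in \<open>J\<close> only on sequences of possible successive moves
  of ONE; elsewhere \<open>F\<close> is arbitrary and its values are never used.
  In \<open>SMG\<close>, the rules make the moves of ONE increasing, but not strictly.
\<close>

definition MG_tactic ::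
  "nat \<Rightarrow> 'a set set \<Rightarrow> 'a set set \<Rightarrow> ('a set list \<Rightarrow> 'a set) \<Rightarrow> bool" where
  "MG_tactic k \<A> J F \<longleftrightarrow>
     (\<forall>xs. 1 \<le> length xs \<and> length xs \<le> k \<and> set xs \<subseteq> \<A> \<and> sorted_wrt (\<subset>) xs \<longrightarrow> F xs \<in> J)"

definition MG_winning_tactic ::
  "nat \<Rightarrow> 'a set set \<Rightarrow> 'a set set \<Rightarrow> ('a set list \<Rightarrow> 'a set) \<Rightarrow> bool" where
  "MG_winning_tactic k \<A> J F \<longleftrightarrow>
     MG_tactic k \<A> J F \<and>
     (\<forall>X Y. MG_play \<A> J X Y \<and> follows_tactic k F X Y \<longrightarrow> MG_won_by_TWO X Y)"

definition SMG_tactic ::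
  "nat \<Rightarrow> 'a set set \<Rightarrow> ('a set list \<Rightarrow> 'a set) \<Rightarrow> bool" where
  "SMG_tactic k J F \<longleftrightarrow>
     (\<forall>xs. 1 \<le> length xs \<and> length xs \<le> k \<and> set xs \<subseteq> sigma_completion J \<and> sorted_wrt (\<subseteq>) xs
        \<longrightarrow> F xs \<in> J)"

definition SMG_winning_tactic ::
  "nat \<Rightarrow> 'a set set \<Rightarrow> ('a set list \<Rightarrow> 'a set) \<Rightarrow> bool" where
  "SMG_winning_tactic k J F \<longleftrightarrow>
     SMG_tactic k J F \<and>
     (\<forall>X Y. SMG_play J X Y \<and> follows_tactic k F X Y \<longrightarrow> SMG_won_by_TWO X Y)"

end

(*
  Each move O of ONE in SMG is replaced by k moves in MG, the images under \<Phi>2 of the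
  chain O, O \<union> \<Phi>1 O, ... of length k. TWO always includes in her answer the finitely many values
  of \<Phi>1 along this chain, so ONE's next move contains the whole chain and hypothesis (b) makes
  the concatenation of all these blocks a strictly increasing sequence. A window of k
  consecutive terms meets at most two consecutive blocks, hence is computed from the last
  two moves of ONE. So a 2-tactic can contain all answers of the k-tactic of MG.
*)
theory Submission
  imports Defs
begin

lemma free_ideal_Un: "free_ideal S J \<Longrightarrow> A \<in> J \<Longrightarrow> B \<in> J \<Longrightarrow> A \<union> B \<in> J"
  by (simp add: free_ideal_def)

lemma free_ideal_finite_UN:
  assumes "free_ideal S J" and "finite I" and "\<And>i. i \<in> I \<Longrightarrow> A i \<in> J"
  shows "(\<Union>i\<in>I. A i) \<in> J"
  using assms(2,3)
proof (induction I)
  case empty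
  then show ?case using assms(1) by (simp add: free_ideal_def)
next
  case (insert i I)
  then show ?case using free_ideal_Un[OF assms(1)] by simp
qed

lemma sigma_completion_Un_ideal:
  assumes "A \<in> sigma_completion J" and "B \<in> J"
  shows "A \<union> B \<in> sigma_completion J"
proof -
  obtain C where "countable C" "C \<subseteq> J" "A = \<Union>C"
    using assms(1) by (auto simp: sigma_completion_def)
  then have "countable (insert B C)" "insert B C \<subseteq> J" "A \<union> B = \<Union>(insert B C)"
    using assms(2) by auto
  then show ?thesis unfolding sigma_completion_def by blast
qed

text \<open>Needed to turn a strictly increasing sequence in \<open>\<A>\<close>, answered by
  \<open>F\<close>, into a play of MG, whose rules also ask the answers to lie in
  \<open>J\<close>.\<close>

lemma MG_tactic_last_moves:
  assumes tac: "MG_tactic k \<A> J F" and "k \<ge> 1"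
    and X: "\<And>n. X n \<in> \<A>" "\<And>n. X n \<subset> X (Suc n)"
  shows "F (last_moves k X n) \<in> J"
proof -
  have mono: "X i \<subset> X j" if "i < j" for i j
    using X(2) that by (rule lift_Suc_mono_less)
  have "sorted_wrt (\<subset>) (last_moves k X n)"
    unfolding last_moves_def sorted_wrt_map
    by (rule sorted_wrt_mono_rel[OF _ sorted_wrt_upt]) (rule mono)
  moreover have "1 \<le> length (last_moves k X n)" "length (last_moves k X n) \<le> k"
    using \<open>k \<ge> 1\<close> by (auto simp: last_moves_def)
  moreover have "set (last_moves k X n) \<subseteq> \<A>"
    using X(1) by (auto simp: last_moves_def)
  ultimately show ?thesis using tac by (simp add: MG_tactic_def)
qed

locale game_reduction =
  fixes S :: "'a set" and J \<A> :: "'a set set" and \<Phi>\<^sub>1 \<Phi>\<^sub>2 :: "'a set \<Rightarrow> 'a set"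
    and k :: nat and F :: "'a set list \<Rightarrow> 'a set"
  assumes ideal: "free_ideal S J"
    and k_pos: "k \<ge> 1"
    and \<Phi>1_in: "A \<in> sigma_completion J \<Longrightarrow> \<Phi>\<^sub>1 A \<in> J"
    and \<Phi>2_in: "A \<in> sigma_completion J \<Longrightarrow> \<Phi>\<^sub>2 A \<in> \<A>"
    and \<Phi>2_superset: "A \<in> sigma_completion J \<Longrightarrow> A \<subset> \<Phi>\<^sub>2 A"
    and \<Phi>2_strict: "A \<in> sigma_completion J \<Longrightarrow> B \<in> sigma_completion J \<Longrightarrow>
      A \<union> \<Phi>\<^sub>1 A \<subseteq> B \<Longrightarrow> \<Phi>\<^sub>2 A \<subset> \<Phi>\<^sub>2 B"
    and winning: "MG_winning_tactic k \<A> J F"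
begin

text \<open>\<open>B \<union> \<Phi>\<^sub>1 B\<close> is the least set that may follow
  \<open>B\<close> in hypothesis (b).\<close>

definition chain :: "'a set \<Rightarrow> nat \<Rightarrow> 'a set" where
  "chain A i = ((\<lambda>B. B \<union> \<Phi>\<^sub>1 B) ^^ i) A"

definition \<Psi> :: "'a set \<Rightarrow> 'a set" where
  "\<Psi> A = (\<Union>i<k. \<Phi>\<^sub>1 (chain A i))"

definition block :: "'a set \<Rightarrow> 'a set list" where
  "block A = map (\<lambda>i. \<Phi>\<^sub>2 (chain A i)) [0..<k]"

text \<open>The test in the second clause guarantees that \<open>F\<close> is only evaluated on legal sequences
  of moves; in a play according to \<open>two_tactic\<close> it always succeeds.\<close>

fun two_tactic :: "'a set list \<Rightarrow> 'a set" where
  "two_tactic [A] = \<Psi> A \<union> (\<Union>i<k. F (take (Suc i) (block A)))"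
| "two_tactic [A, B] = \<Psi> B \<union>
     (if A \<union> \<Psi> A \<subseteq> B then \<Union>i<k. F (take k (drop (Suc i) (block A @ block B))) else {})"
| "two_tactic _ = {}"

lemma chain_0 [simp]: "chain A 0 = A"
  by (simp add: chain_def)

lemma chain_Suc [simp]: "chain A (Suc i) = chain A i \<union> \<Phi>\<^sub>1 (chain A i)"
  by (simp add: chain_def)

lemma chain_in: "A \<in> sigma_completion J \<Longrightarrow> chain A i \<in> sigma_completion J"
  by (induction i) (auto intro: sigma_completion_Un_ideal \<Phi>1_in)

lemma chain_mono: "i \<le> j \<Longrightarrow> chain A i \<subseteq> chain A j"
  by (rule lift_Suc_mono_le) auto

text \<open>Each step adds one of the sets united in \<open>\<Psi> A\<close>. The bound reaches
  \<open>k\<close>, one past the last index in \<open>block A\<close>, so that hypothesis (b) can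
  also be applied to the last entry of the block.\<close>

lemma chain_subset: "i \<le> k \<Longrightarrow> chain A i \<subseteq> A \<union> \<Psi> A"
  by (induction i) (auto simp: \<Psi>_def)

lemma \<Psi>_in: "A \<in> sigma_completion J \<Longrightarrow> \<Psi> A \<in> J"
  unfolding \<Psi>_def by (rule free_ideal_finite_UN[OF ideal]) (auto intro: \<Phi>1_in chain_in)

text \<open>Hypothesis (b) applies to the two terms directly, because \<open>chain A (Suc i)\<close>
  lies in \<open>chain A j\<close>.\<close>

lemma \<Phi>2_chain_strict:
  assumes "A \<in> sigma_completion J" and "i < j"
  shows "\<Phi>\<^sub>2 (chain A i) \<subset> \<Phi>\<^sub>2 (chain A j)"
  using chain_mono[of "Suc i" j A] assms by (intro \<Phi>2_strict chain_in) auto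

lemma \<Phi>2_chain_strict_next:
  assumes "A \<in> sigma_completion J" and "B \<in> sigma_completion J"
    and "A \<union> \<Psi> A \<subseteq> B" and "i < k"
  shows "\<Phi>\<^sub>2 (chain A i) \<subset> \<Phi>\<^sub>2 (chain B j)"
proof (intro \<Phi>2_strict chain_in assms)
  have "chain A (Suc i) \<subseteq> A \<union> \<Psi> A"
    using assms(4) by (intro chain_subset) simp
  also have "\<dots> \<subseteq> chain B j"
    using assms(3) chain_mono[of 0 j B] by (metis chain_0 le0 order_trans)
  finally show "chain A i \<union> \<Phi>\<^sub>1 (chain A i) \<subseteq> chain B j"
    by simp
qed

lemma set_block: "A \<in> sigma_completion J \<Longrightarrow> set (block A) \<subseteq> \<A>"
  by (auto simp: block_def intro: \<Phi>2_in chain_in)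

lemma length_block [simp]: "length (block A) = k"
  by (simp add: block_def)

lemma sorted_block: "A \<in> sigma_completion J \<Longrightarrow> sorted_wrt (\<subset>) (block A)"
  unfolding block_def sorted_wrt_map
  by (rule sorted_wrt_mono_rel[OF _ sorted_wrt_upt]) (rule \<Phi>2_chain_strict)

lemma sorted_blocks:
  assumes "A \<in> sigma_completion J" and "B \<in> sigma_completion J" and "A \<union> \<Psi> A \<subseteq> B"
  shows "sorted_wrt (\<subset>) (block A @ block B)"
  unfolding sorted_wrt_append using assms sorted_block \<Phi>2_chain_strict_next[OF assms]
  by (auto simp: block_def)

lemma F_in:
  assumes "1 \<le> length xs" and "length xs \<le> k" and "set xs \<subseteq> \<A>" and "sorted_wrt (\<subset>) xs"
  shows "F xs \<in> J"
  using winning assms by (simp add: MG_winning_tactic_def MG_tactic_def)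

lemma two_tactic_single:
  assumes "A \<in> sigma_completion J"
  shows "two_tactic [A] \<in> J"
proof -
  have "F (take (Suc i) (block A)) \<in> J" if "i < k" for i
    using that set_block[OF assms] set_take_subset[of "Suc i" "block A"]
    by (intro F_in sorted_wrt_take sorted_block assms) auto
  then show ?thesis
    using \<Psi>_in[OF assms] by (auto intro!: free_ideal_Un[OF ideal] free_ideal_finite_UN[OF ideal])
qed

text \<open>No inclusion between \<open>A\<close> and \<open>B\<close> is assumed. If the guard
  fails, the joined blocks need not increase, and the answer is just
  \<open>\<Psi> B\<close>.\<close>

lemma two_tactic_pair:
  assumes "A \<in> sigma_completion J" and "B \<in> sigma_completion J"
  shows "two_tactic [A, B] \<in> J"
proof (cases "A \<union> \<Psi> A \<subseteq> B")
  case True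
  \<comment> \<open>The window occupies positions \<open>Suc i\<close> to \<open>k + i\<close>, so
    it ends at entry \<open>i\<close> of \<open>block B\<close> and has full length
    \<open>k\<close>.\<close>
  have "F (take k (drop (Suc i) (block A @ block B))) \<in> J" if "i < k" for i
  proof (rule F_in)
    have "set (take k (drop (Suc i) (block A @ block B))) \<subseteq> set (block A @ block B)"
      by (meson order_trans set_drop_subset set_take_subset)
    then show "set (take k (drop (Suc i) (block A @ block B))) \<subseteq> \<A>"
      using set_block[OF assms(1)] set_block[OF assms(2)] by auto
    show "sorted_wrt (\<subset>) (take k (drop (Suc i) (block A @ block B)))"
      by (intro sorted_wrt_take sorted_wrt_drop sorted_blocks assms True)
  qed (use that k_pos in auto)
  then have "(\<Union>i<k. F (take k (drop (Suc i) (block A @ block B)))) \<in> J"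
    by (intro free_ideal_finite_UN[OF ideal]) auto
  then show ?thesis
    using True free_ideal_Un[OF ideal \<Psi>_in[OF assms(2)]] by simp
next
  case False
  then show ?thesis using \<Psi>_in[OF assms(2)] by auto
qed

lemma SMG_tactic_two_tactic: "SMG_tactic 2 J two_tactic"
  unfolding SMG_tactic_def
proof (intro allI impI)
  fix xs :: "'a set list"
  assume xs: "1 \<le> length xs \<and> length xs \<le> 2 \<and> set xs \<subseteq> sigma_completion J \<and> sorted_wrt (\<subseteq>) xs"
  then consider A where "xs = [A]" | A B where "xs = [A, B]"
    by (cases xs rule: two_tactic.cases) auto
  then show "two_tactic xs \<in> J"
    using xs by cases (use two_tactic_single two_tactic_pair in \<open>auto simp del: two_tactic.simps\<close>)
qed

lemma SMG_won_two_tactic: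
  assumes play: "SMG_play J X Y" and follows: "follows_tactic 2 two_tactic X Y"
  shows "SMG_won_by_TWO X Y"
proof -
  have X_in: "X n \<in> sigma_completion J" and X_Y: "X n \<union> Y n \<subseteq> X (Suc n)" for n
    using play by (auto simp: SMG_play_def)
  have Y_0: "Y 0 = two_tactic [X 0]"
    using follows by (simp add: follows_tactic_def last_moves_def)
  have Y_Suc: "Y (Suc n) = two_tactic [X n, X (Suc n)]" for n
    using follows by (simp add: follows_tactic_def last_moves_def numeral_2_eq_2)
  \<comment> \<open>This holds whether or not the guard succeeds. The rules of SMG then put
    \<open>\<Psi> (X n)\<close> into ONE's next move, so the guard succeeds throughout the
    play.\<close>
  have "\<Psi> (X n) \<subseteq> Y n" for n
    by (cases n) (auto simp: Y_0 Y_Suc)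
  then have step: "X n \<union> \<Psi> (X n) \<subseteq> X (Suc n)" for n
    using X_Y[of n] by blast
  \<comment> \<open>The concatenation of all blocks: index \<open>n * k + i\<close> is entry
    \<open>i\<close> of the block of \<open>X n\<close>.\<close>
  define Z where "Z m = \<Phi>\<^sub>2 (chain (X (m div k)) (m mod k))" for m
  have Z_in: "Z m \<in> \<A>" for m
    by (simp add: Z_def \<Phi>2_in chain_in X_in)
  have Z_strict: "Z m \<subset> Z (Suc m)" for m
  proof (cases "Suc (m mod k) = k")
    \<comment> \<open>Here \<open>m\<close> is the last index of a block and \<open>Suc m\<close>
      the first index of the next one.\<close>
    case True
    then show ?thesis
      using \<Phi>2_chain_strict_next[OF X_in X_in step[of "m div k"], of "m mod k" 0] k_pos
      by (simp add: Z_def div_Suc mod_Suc)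
  next
    case False
    then show ?thesis
      by (simp add: Z_def div_Suc mod_Suc \<Phi>2_chain_strict X_in del: chain_Suc)
  qed
  have Z_nth: "Z (n * k + i) = \<Phi>\<^sub>2 (chain (X n) i)" if "i < k" for n i
    using that by (simp add: Z_def)
  have block_Z: "block (X n) = map Z [n * k..<n * k + k]" for n
    by (rule nth_equalityI) (auto simp: block_def Z_nth)
  have blocks_Z: "block (X n) @ block (X (Suc n)) = map Z [n * k..<n * k + k + k]" for n
  proof -
    have "[n * k..<n * k + k + k] = [n * k..<n * k + k] @ [n * k + k..<n * k + k + k]"
      by (rule upt_add_eq_append) simp
    then show ?thesis by (simp add: block_Z add.commute)
  qed
  \<comment> \<open>Inning \<open>m\<close> of MG is charged to inning \<open>m div k\<close> of
    SMG, in whose block the window ends; at most \<open>k - 1\<close> of its entries come from the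
    block before.\<close>
  have F_subset: "F (last_moves k Z m) \<subseteq> Y (m div k)" for m
  proof (cases "m div k")
    case 0
    then have "m < k"
      using k_pos by (simp add: div_eq_0_iff)
    \<comment> \<open>Since \<open>Suc m \<le> k\<close>, the truncated difference
      \<open>Suc m - k\<close> is 0 and the window is a prefix of the first block.\<close>
    moreover from this have "last_moves k Z m = take (Suc m) (block (X 0))"
      by (simp add: last_moves_def block_Z take_map del: upt_Suc)
    ultimately show ?thesis
      by (auto simp: 0 Y_0)
  next
    case (Suc n)
    define i where "i = m mod k"
    have i: "i < k" using k_pos by (simp add: i_def)
    have m: "m = n * k + k + i"
      using div_mult_mod_eq[of m k] by (simp add: Suc i_def add.commute)
    \<comment> \<open>The window starts at \<open>Suc m - k = n * k + Suc i\<close>, which is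
      position \<open>Suc i\<close> of the two joined blocks.\<close>
    have "last_moves k Z m = take k (drop (Suc i) (block (X n) @ block (X (Suc n))))"
      using i by (simp add: last_moves_def blocks_Z take_map drop_map m ac_simps
          del: upt_Suc)
    then show ?thesis
      using i step[of n] by (auto simp: Suc Y_Suc)
  qed
  have "F (last_moves k Z m) \<in> J" for m
    using winning unfolding MG_winning_tactic_def
    by (blast intro: MG_tactic_last_moves[where X = Z, OF _ k_pos Z_in Z_strict])
  then have "MG_play \<A> J Z (\<lambda>m. F (last_moves k Z m))"
    using Z_in Z_strict by (simp add: MG_play_def)
  moreover have "follows_tactic k F Z (\<lambda>m. F (last_moves k Z m))"
    by (simp add: follows_tactic_def)
  ultimately have "MG_won_by_TWO Z (\<lambda>m. F (last_moves k Z m))"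
    using winning unfolding MG_winning_tactic_def by blast
  then have "(\<Union>m. Z m) \<subseteq> (\<Union>m. F (last_moves k Z m))"
    by (simp only: MG_won_by_TWO_def)
  also have "\<dots> \<subseteq> (\<Union>n. Y n)"
    using F_subset by blast
  finally have Z_Y: "(\<Union>m. Z m) \<subseteq> (\<Union>n. Y n)" .
  \<comment> \<open>Each chain starts at ONE's own move, so entry 0 of the block is
    \<open>\<Phi>\<^sub>2 (X n)\<close>.\<close>
  have "X n \<subseteq> Z (n * k)" for n
    using \<Phi>2_superset[OF X_in, of n] Z_nth[of 0 n] k_pos by auto
  then have "(\<Union>n. X n) \<subseteq> (\<Union>m. Z m)"
    by blast
  then have "(\<Union>n. X n) \<subseteq> (\<Union>n. Y n)"
    using Z_Y by (rule order_trans)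
  \<comment> \<open>This inclusion comes from the rules of SMG alone: \<open>Y n\<close> lies in
    \<open>X (Suc n)\<close>.\<close>
  moreover have "(\<Union>n. Y n) \<subseteq> (\<Union>n. X n)"
    using X_Y by blast
  ultimately show ?thesis
    unfolding SMG_won_by_TWO_def by (rule subset_antisym)
qed

lemma SMG_winning_two_tactic: "SMG_winning_tactic 2 J two_tactic"
  using SMG_tactic_two_tactic SMG_won_two_tactic by (simp add: SMG_winning_tactic_def)

end

theorem theorem26:
  fixes S :: "'a set" and J \<A> :: "'a set set" and k :: nat
  assumes "free_ideal S J"
    and "S \<notin> sigma_completion J"
    and "k \<ge> 1"
    and "cofinal_subfamily \<A> (sigma_completion J)"
    and "\<exists>F. MG_winning_tactic k \<A> J F"
    and "\<exists>\<Phi>\<^sub>1 \<Phi>\<^sub>2.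
           (\<forall>A\<in>sigma_completion J. \<Phi>\<^sub>1 A \<in> J) \<and>
           (\<forall>A\<in>sigma_completion J. \<Phi>\<^sub>2 A \<in> \<A>) \<and>
           (\<forall>A\<in>sigma_completion J. A \<subset> \<Phi>\<^sub>2 A) \<and>
           (\<forall>A\<in>sigma_completion J. \<forall>B\<in>sigma_completion J.
              A \<union> \<Phi>\<^sub>1 A \<subseteq> B \<longrightarrow> \<Phi>\<^sub>2 A \<subset> \<Phi>\<^sub>2 B)"
  shows "\<exists>F. SMG_winning_tactic 2 J F"
proof -
  obtain F where F: "MG_winning_tactic k \<A> J F"
    using assms(5) by blast
  obtain \<Phi>\<^sub>1 \<Phi>\<^sub>2 where \<Phi>:
    "\<forall>A\<in>sigma_completion J. \<Phi>\<^sub>1 A \<in> J"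
    "\<forall>A\<in>sigma_completion J. \<Phi>\<^sub>2 A \<in> \<A>"
    "\<forall>A\<in>sigma_completion J. A \<subset> \<Phi>\<^sub>2 A"
    "\<forall>A\<in>sigma_completion J. \<forall>B\<in>sigma_completion J. A \<union> \<Phi>\<^sub>1 A \<subseteq> B \<longrightarrow> \<Phi>\<^sub>2 A \<subset> \<Phi>\<^sub>2 B"
    using assms(6) by (elim exE conjE) (rule that)
  interpret game_reduction S J \<A> \<Phi>\<^sub>1 \<Phi>\<^sub>2 k F
    by unfold_locales (use assms(1,3) F \<Phi> in simp_all)
  show ?thesis
    using SMG_winning_two_tactic by blast
qed

end
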